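(* Let $n\ge 2$, $s\in(0,1)$, and let $p\in\left(1,\frac{n+2}{n-2}\right)$ if $n>2$, $p\in(1,+\infty)$ if $n=2$. Let $\mathscr{F}^+$ be the functional and $c$ the mountain pass level defined in the context. Let $\bar u$ be a nontrivial critical point of $\mathscr{F}^+$ obtained as follows: $\{u_k\}\subset H^1(\mathbb{R}^n)$ is a sequence with $\mathscr{F}^+(u_k)\to c$ and $\nabla\mathscr{F}^+(u_k)\to0$ as $k\to+\infty$, $\{y_k\}\subset\mathbb{R}^n$ is a sequence of points, and the translated functions $\bar u_k(x):=u_k(x+y_k)$ converge to $\bar u\not\equiv0$ weakly in $H^1(\mathbb{R}^n)$ and strongly in $L^q_{loc}(\mathbb{R}^n)$ for all $q\in(1,2^* )$. Then $$\mathscr{F}^+(\bar u)=c.$$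
   Context: Notation: $u^+:=\max\{u,0\}$; $2^*=\frac{2n}{n-2}$ if $n>2$ and $2^*=+\infty$ if $n=2$. $$\|u\|_s^2:=\|u\|^2_{L^2(\mathbb{R}^n)}+\|\nabla u\|^2_{L^2(\mathbb{R}^n)}+\iint_{\mathbb{R}^{2n}}\frac{|u(x)-u(y)|^2}{|x-y|^{n+2s}}\,dx\,dy,$$ which is an equivalent (squared) norm on $H^1(\mathbb{R}^n)$, with associated scalar product $\langle\cdot,\cdot\rangle_s$. The functional $\mathscr{F}^+:H^1(\mathbb{R}^n)\to\mathbb{R}$ is $$\mathscr{F}^+(u):=\frac12\|u\|_s^2-\frac1{p+1}\int_{\mathbb{R}^n}(u^+)^{p+1}(x)\,dx,$$ which is $C^1$ with $\langle\nabla\mathscr{F}^+(u),\varphi\rangle=\langle u,\varphi\rangle_s-\int_{\mathbb{R}^n}(u^+)^p\varphi\,dx$; the convergence $\nabla\mathscr{F}^+(u_k)\to0$ is in the dual of $H^1(\mathbb{R}^n)$. A critical point is $u\in H^1(\mathbb{R}^n)$ with $\nabla\mathscr{F}^+(u)=0$. Let $$\Gamma:=\{\gamma\in C([0,1],H^1(\mathbb{R}^n)):\gamma(0)=0,\ \mathscr{F}^+(\gamma(1))<0\},\qquad c:=\inf_{\gamma\in\Gamma}\sup_{t\in[0,1]}\mathscr{F}^+(\gamma(t)).$$ *)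

theory Defs
  imports "HOL-Analysis.Analysis"
begin

text \<open>
  The Euclidean space \<open>\<real>\<^sup>n\<close> is an arbitrary type \<open>'a :: euclidean_space\<close>, with \<open>n = DIM('a)\<close>.
  Elements of Lebesgue and Sobolev spaces are represented by Borel measurable functions
  \<open>'a \<Rightarrow> real\<close> (every a.e.-class has such a representative); two functions represent the same
  element iff they agree almost everywhere, and all notions below respect a.e. equality.
\<close>

subsection \<open>Test functions and weak gradients\<close>

text \<open>\<open>C_diff k f\<close>: \<open>f\<close> is of class \<open>C\<^sup>k\<close> on the whole space.\<close>

primrec C_diff :: "nat \<Rightarrow> ('a::euclidean_space \<Rightarrow> real) \<Rightarrow> bool" where
  "C_diff 0 f \<longleftrightarrow> continuous_on UNIV f"
| "C_diff (Suc k) f \<longleftrightarrow> f differentiable_on UNIV \<and>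
     (\<forall>b\<in>Basis. C_diff k (\<lambda>x. frechet_derivative f (at x) b))"

definition test_functions :: "('a::euclidean_space \<Rightarrow> real) set" where
  "test_functions = {\<phi>. (\<forall>k. C_diff k \<phi>) \<and> compact (closure {x. \<phi> x \<noteq> 0})}"

definition has_weak_gradient :: "('a::euclidean_space \<Rightarrow> real) \<Rightarrow> ('a \<Rightarrow> 'a) \<Rightarrow> bool" where
  "has_weak_gradient u g \<longleftrightarrow>
     (\<forall>\<phi>\<in>test_functions. \<forall>b\<in>Basis.
        (LINT x|lborel. u x * frechet_derivative \<phi> (at x) b) = - (LINT x|lborel. (g x \<bullet> b) * \<phi> x))"

subsection \<open>The Sobolev space of order one\<close>

definition L2 :: "('a::euclidean_space \<Rightarrow> 'b::euclidean_space) set" where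
  "L2 = {u. u \<in> borel_measurable lborel \<and> integrable lborel (\<lambda>x. (norm (u x))\<^sup>2)}"

definition H1 :: "('a::euclidean_space \<Rightarrow> real) set" where
  "H1 = {u. u \<in> L2 \<and> (\<exists>g\<in>L2. has_weak_gradient u g)}"

text \<open>The weak gradient is unique up to a.e. equality, so the choice is immaterial.\<close>

definition weak_gradient :: "('a::euclidean_space \<Rightarrow> real) \<Rightarrow> 'a \<Rightarrow> 'a" where
  "weak_gradient u = (SOME g. g \<in> L2 \<and> has_weak_gradient u g)"

definition H1_norm :: "('a::euclidean_space \<Rightarrow> real) \<Rightarrow> real" where
  "H1_norm u = sqrt ((LINT x|lborel. (u x)\<^sup>2) + (LINT x|lborel. (norm (weak_gradient u x))\<^sup>2))"

definition H1_dual :: "(('a::euclidean_space \<Rightarrow> real) \<Rightarrow> real) set" where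
  "H1_dual = {L. (\<forall>u\<in>H1. \<forall>v\<in>H1. \<forall>a b. L (\<lambda>x. a * u x + b * v x) = a * L u + b * L v) \<and>
                 (\<exists>C. \<forall>u\<in>H1. \<bar>L u\<bar> \<le> C * H1_norm u)}"

definition H1_dual_norm :: "(('a::euclidean_space \<Rightarrow> real) \<Rightarrow> real) \<Rightarrow> real" where
  "H1_dual_norm L = (SUP \<phi>\<in>{\<phi>\<in>H1. H1_norm \<phi> \<le> 1}. \<bar>L \<phi>\<bar>)"

definition H1_weakly_converges ::
    "(nat \<Rightarrow> 'a::euclidean_space \<Rightarrow> real) \<Rightarrow> ('a \<Rightarrow> real) \<Rightarrow> bool" where
  "H1_weakly_converges v w \<longleftrightarrow>
     (\<forall>k. v k \<in> H1) \<and> w \<in> H1 \<and> (\<forall>L\<in>H1_dual. (\<lambda>k. L (v k)) \<longlonglongrightarrow> L w)"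

text \<open>
  Frechet differentiability on \<open>H\<^sup>1\<close>: the bounded linear functional \<open>L\<close> is the derivative
  (the gradient, as an element of the dual) of \<open>F\<close> at \<open>u\<close>.
\<close>

definition has_H1_gradient ::
    "(('a::euclidean_space \<Rightarrow> real) \<Rightarrow> real) \<Rightarrow> ('a \<Rightarrow> real) \<Rightarrow> (('a \<Rightarrow> real) \<Rightarrow> real) \<Rightarrow> bool" where
  "has_H1_gradient F u L \<longleftrightarrow> L \<in> H1_dual \<and>
     (\<forall>\<epsilon>>0. \<exists>\<delta>>0. \<forall>\<phi>\<in>H1. H1_norm \<phi> < \<delta> \<longrightarrow>
        \<bar>F (\<lambda>x. u x + \<phi> x) - F u - L \<phi>\<bar> \<le> \<epsilon> * H1_norm \<phi>)"

definition H1_critical_point :: "(('a::euclidean_space \<Rightarrow> real) \<Rightarrow> real) \<Rightarrow> ('a \<Rightarrow> real) \<Rightarrow> bool" where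
  "H1_critical_point F u \<longleftrightarrow> u \<in> H1 \<and> has_H1_gradient F u (\<lambda>\<phi>. 0)"

subsection \<open>Local convergence in Lebesgue spaces\<close>

definition Lq_loc :: "real \<Rightarrow> ('a::euclidean_space \<Rightarrow> real) set" where
  "Lq_loc q = {u. u \<in> borel_measurable lborel \<and>
     (\<forall>K. compact K \<longrightarrow> (\<integral>\<^sup>+x\<in>K. ennreal (\<bar>u x\<bar> powr q) \<partial>lborel) < \<infinity>)}"

definition Lq_loc_converges ::
    "real \<Rightarrow> (nat \<Rightarrow> 'a::euclidean_space \<Rightarrow> real) \<Rightarrow> ('a \<Rightarrow> real) \<Rightarrow> bool" where
  "Lq_loc_converges q v w \<longleftrightarrow> (\<forall>k. v k \<in> Lq_loc q) \<and> w \<in> Lq_loc q \<and>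
     (\<forall>K. compact K \<longrightarrow>
        (\<lambda>k. \<integral>\<^sup>+x\<in>K. ennreal (\<bar>v k x - w x\<bar> powr q) \<partial>lborel) \<longlonglongrightarrow> 0)"

definition sobolev_exponent :: "nat \<Rightarrow> ereal" where
  "sobolev_exponent n = (if n > 2 then ereal (2 * real n / (real n - 2)) else \<infinity>)"

subsection \<open>The functional and its mountain pass level\<close>

text \<open>On the diagonal the integrand of the double integral is 0 by convention; the diagonal is a
  null set.\<close>

definition norm_s_sq :: "real \<Rightarrow> ('a::euclidean_space \<Rightarrow> real) \<Rightarrow> real" where
  "norm_s_sq s u =
     (LINT x|lborel. (u x)\<^sup>2) + (LINT x|lborel. (norm (weak_gradient u x))\<^sup>2) +
     (LINT (x, y)|(lborel \<Otimes>\<^sub>M lborel).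
        \<bar>u x - u y\<bar>\<^sup>2 / norm (x - y) powr (real DIM('a) + 2 * s))"

definition F_plus :: "real \<Rightarrow> real \<Rightarrow> ('a::euclidean_space \<Rightarrow> real) \<Rightarrow> real" where
  "F_plus s p u =
     1 / 2 * norm_s_sq s u - 1 / (p + 1) * (LINT x|lborel. (max (u x) 0) powr (p + 1))"

text \<open>Only the values of a path on \<open>[0,1]\<close> matter; continuity is with respect to the \<open>H\<^sup>1\<close> norm.\<close>

definition mountain_pass_paths ::
    "(('a::euclidean_space \<Rightarrow> real) \<Rightarrow> real) \<Rightarrow> (real \<Rightarrow> 'a \<Rightarrow> real) set" where
  "mountain_pass_paths F = {\<gamma>.
     (\<forall>t\<in>{0..1}. \<gamma> t \<in> H1) \<and>
     (\<forall>t\<in>{0..1}. ((\<lambda>r. H1_norm (\<lambda>x. \<gamma> r x - \<gamma> t x)) \<longlongrightarrow> 0) (at t within {0..1})) \<and>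
     (AE x in lborel. \<gamma> 0 x = 0) \<and> F (\<gamma> 1) < 0}"

text \<open>Infimum and supremum are taken in the extended reals, where they always exist.\<close>

definition mountain_pass_level :: "(('a::euclidean_space \<Rightarrow> real) \<Rightarrow> real) \<Rightarrow> ereal" where
  "mountain_pass_level F = (INF \<gamma>\<in>mountain_pass_paths F. SUP t\<in>{0..1}. ereal (F (\<gamma> t)))"

end

theory Submission
  imports Defs
begin

text \<open>
  For \<open>w\<close> in \<open>H\<^sup>1\<close> write \<open>N\<close> for its squared \<open>s\<close>-norm and \<open>P\<close> for the integral of
  \<open>(w\<^sup>+)\<^sup>p\<^sup>+\<^sup>1\<close>. Along the ray through \<open>w\<close> the functional is
  \<open>t\<^sup>2 N / 2 - t\<^sup>p\<^sup>+\<^sup>1 P / (p + 1)\<close>, so the gradient at \<open>w\<close> applied to \<open>w\<close> is \<open>N - P\<close>.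
  At the critical point \<open>N = P > 0\<close>; then the ray attains its maximum at \<open>t = 1\<close> and is
  eventually negative, hence an admissible path, and the mountain pass level \<open>c\<close> is at most
  the critical value \<open>\<theta> P\<close> with \<open>\<theta> = 1/2 - 1/(p + 1)\<close>.
  Conversely, a Palais--Smale sequence at level \<open>c\<close> is bounded and satisfies
  \<open>\<theta> P\<^sub>k \<rightarrow> c\<close>; since \<open>P\<close> is translation invariant and lower semicontinuous under local
  convergence, \<open>\<theta> P \<le> c\<close> for the limit. The Sobolev embedding is not needed.
\<close>

subsection \<open>Smooth bump functions on boxes\<close>

lemma C_diff_imp_continuous: "C_diff k f \<Longrightarrow> continuous_on UNIV f"
  by (cases k) (auto intro: differentiable_imp_continuous_on)

lemma C_diff_SucD: "C_diff (Suc k) f \<Longrightarrow> C_diff k f"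
proof (induction k arbitrary: f)
  case 0
  then show ?case by (auto intro: differentiable_imp_continuous_on)
next
  case (Suc k)
  then show ?case by (metis C_diff.simps(2))
qed

text \<open>Since derivatives are unique, any explicit formula may stand in for
  \<open>frechet_derivative\<close>, so smoothness can be proved with the usual differentiation
  rules.\<close>

lemma C_diff_SucI:
  assumes "\<And>x. (f has_derivative f' x) (at x)" "\<And>b. b \<in> Basis \<Longrightarrow> C_diff k (\<lambda>x. f' x b)"
  shows "C_diff (Suc k) f"
proof -
  have "frechet_derivative f (at x) = f' x" for x
    using frechet_derivative_at[OF assms(1)] by simp
  moreover have "f differentiable_on UNIV"
    using assms(1) by (auto simp: differentiable_on_def differentiable_def)
  ultimately show ?thesis using assms(2) by simp
qed

lemma C_diff_Suc_has_derivative: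
  assumes "C_diff (Suc k) f"
  shows "(f has_derivative frechet_derivative f (at x)) (at x)"
  using assms by (auto simp: differentiable_on_def frechet_derivative_works)

lemma C_diff_const: "C_diff k (\<lambda>x. c)"
proof (induction k arbitrary: c)
  case (Suc k)
  show ?case by (rule C_diff_SucI[where f'="\<lambda>x v. 0"]) (auto intro: Suc)
qed simp

lemma C_diff_inner: "C_diff k (\<lambda>x. x \<bullet> i)"
proof (cases k)
  case (Suc k)
  show ?thesis unfolding Suc
    by (rule C_diff_SucI[where f'="\<lambda>x v. v \<bullet> i"]) (auto intro!: derivative_eq_intros C_diff_const)
qed (auto intro!: continuous_intros)

lemma C_diff_add: "C_diff k f \<Longrightarrow> C_diff k g \<Longrightarrow> C_diff k (\<lambda>x. f x + g x)"
proof (induction k arbitrary: f g)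
  case (Suc k)
  note f = C_diff_Suc_has_derivative[OF Suc.prems(1)] and g = C_diff_Suc_has_derivative[OF Suc.prems(2)]
  show ?case
    by (rule C_diff_SucI[OF has_derivative_add[OF f g]]) (use Suc in auto)
qed (auto intro!: continuous_intros)

lemma C_diff_mult: "C_diff k f \<Longrightarrow> C_diff k g \<Longrightarrow> C_diff k (\<lambda>x. f x * g x)"
proof (induction k arbitrary: f g)
  case (Suc k)
  note f = C_diff_Suc_has_derivative[OF Suc.prems(1)] and g = C_diff_Suc_has_derivative[OF Suc.prems(2)]
  show ?case
    \<comment> \<open>Each term of the product rule keeps one factor undifferentiated, so the
      assumptions are also lowered to order \<open>k\<close>.\<close>
    by (rule C_diff_SucI[OF has_derivative_mult[OF f g]])
      (use Suc.prems Suc.prems[THEN C_diff_SucD] in \<open>auto intro!: C_diff_add Suc.IH\<close>)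
qed (auto intro!: continuous_intros)

lemma C_diff_prod: "(\<And>i. i \<in> I \<Longrightarrow> C_diff k (f i)) \<Longrightarrow> C_diff k (\<lambda>x. \<Prod>i\<in>I. f i x)"
  by (induction I rule: infinite_finite_induct) (auto intro: C_diff_const C_diff_mult)

text \<open>The family is closed under differentiation, which makes all its members smooth.\<close>

definition flat :: "real poly \<Rightarrow> real \<Rightarrow> real" where
  "flat q t = (if t > 0 then poly q (1 / t) * exp (- (1 / t)) else 0)"

lemma poly_exp_minus_tendsto_0: "((\<lambda>x::real. poly q x * exp (- x)) \<longlongrightarrow> 0) at_top"
proof -
  have "((\<lambda>x. \<Sum>i\<le>degree q. coeff q i * (x ^ i / exp x)) \<longlongrightarrow> (\<Sum>i\<le>degree q. coeff q i * 0)) at_top"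
    by (intro tendsto_intros tendsto_power_div_exp_0)
  then show ?thesis
    by (simp add: poly_altdef exp_minus sum_distrib_right divide_inverse mult.assoc)
qed

lemma flat_tendsto_0: "(flat q \<longlongrightarrow> 0) (at 0)"
proof -
  have "((\<lambda>t::real. poly q (1 / t) * exp (- (1 / t))) \<longlongrightarrow> 0) (at_right 0)"
    using filterlim_compose[OF poly_exp_minus_tendsto_0 filterlim_inverse_at_top_right, of q]
    by (simp add: divide_inverse)
  moreover have "eventually (\<lambda>t. poly q (1 / t) * exp (- (1 / t)) = flat q t) (at_right 0)"
    using eventually_at_right_less[of "0::real"] by eventually_elim (simp add: flat_def)
  ultimately have r: "(flat q \<longlongrightarrow> 0) (at_right 0)"
    by (rule Lim_transform_eventually)
  have "eventually (\<lambda>t. 0 = flat q t) (at_left 0)"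
    unfolding eventually_at_filter by (intro always_eventually) (simp add: flat_def)
  then have "(flat q \<longlongrightarrow> 0) (at_left 0)"
    by (rule Lim_transform_eventually[OF tendsto_const])
  with r show ?thesis by (simp add: filterlim_split_at)
qed

text \<open>With z = 1/t the derivative of q(z) exp(-z) in t is z^2 (q(z) - q'(z)) exp(-z), and
  \<open>[:0, 0, 1:]\<close> is the factor z^2.\<close>

lemma flat_has_derivative:
  "(flat q has_real_derivative flat ([:0, 0, 1:] * (q - pderiv q)) t) (at t)"
proof -
  consider "t > 0" | "t < 0" | "t = 0" by linarith
  then show ?thesis
  proof cases
    case 1
    have "((\<lambda>t. poly q (1 / t) * exp (- (1 / t))) has_real_derivative
        flat ([:0, 0, 1:] * (q - pderiv q)) t) (at t)"
      using 1 by (auto intro!: derivative_eq_intros DERIV_chain2[OF poly_DERIV] simp: flat_def field_simps power2_eq_square)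
    then show ?thesis
      by (rule has_field_derivative_transform_within_open[where S="{0<..}"]) (use 1 in \<open>auto simp: flat_def\<close>)
  next
    case 2
    have "((\<lambda>t. 0) has_real_derivative flat ([:0, 0, 1:] * (q - pderiv q)) t) (at t)"
      using 2 by (auto simp: flat_def)
    then show ?thesis
      by (rule has_field_derivative_transform_within_open[where S="{..<0}"]) (use 2 in \<open>auto simp: flat_def\<close>)
  next
    case 3
    \<comment> \<open>Dividing by \<open>h\<close> multiplies the polynomial by its variable, so the
      difference quotients at 0 are values of another member of the family and tend to 0.\<close>
    have "flat q h / h = flat ([:0, 1:] * q) h" for h
      by (simp add: flat_def)
    then have "(\<lambda>h. (flat q (0 + h) - flat q 0) / h) = flat ([:0, 1:] * q)"
      by (auto simp: flat_def)
    moreover have "flat r 0 = 0" for r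
      by (simp add: flat_def)
    ultimately show ?thesis
      using flat_tendsto_0[of "[:0, 1:] * q"] 3 by (simp add: DERIV_def)
  qed
qed

text \<open>The induction must vary \<open>q\<close>, because each use of the chain rule replaces
  the polynomial.\<close>

lemma C_diff_flat: "C_diff k g \<Longrightarrow> C_diff k (\<lambda>x. flat q (g x))"
proof (induction k arbitrary: q g)
  case 0
  have "isCont (flat q) t" for t
    using flat_has_derivative DERIV_isCont by blast
  then have "continuous_on UNIV (flat q)"
    by (simp add: continuous_at_imp_continuous_on)
  with 0 show ?case
    using continuous_on_compose2[of UNIV "flat q" UNIV g] by simp
next
  case (Suc k)
  note g = C_diff_Suc_has_derivative[OF Suc.prems]
  have "((\<lambda>x. flat q (g x)) has_derivative
      (\<lambda>v. flat ([:0, 0, 1:] * (q - pderiv q)) (g x) * frechet_derivative g (at x) v)) (at x)" for x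
    using has_derivative_compose[OF g flat_has_derivative[unfolded has_field_derivative_def]] by simp
  then show ?case
    by (rule C_diff_SucI) (use Suc.prems Suc.prems[THEN C_diff_SucD] in \<open>auto intro!: C_diff_mult Suc.IH\<close>)
qed

text \<open>As \<open>flat 1\<close> is exp(-1/t) for t > 0, growing \<open>m\<close> steepens the
  edges and the bumps tend to the indicator of the box. Differences are spelled as sums and products
  to match the closure rules of \<open>C_diff\<close>.\<close>

definition box_bump :: "'a::euclidean_space \<Rightarrow> 'a \<Rightarrow> real \<Rightarrow> 'a \<Rightarrow> real" where
  "box_bump a b m x =
     (\<Prod>i\<in>Basis. flat 1 (m * (x \<bullet> i + - (a \<bullet> i))) * flat 1 (m * (b \<bullet> i + - 1 * (x \<bullet> i))))"

lemma flat_1_bounds: "0 \<le> flat 1 t" "flat 1 t \<le> 1"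
  by (auto simp: flat_def)

lemma box_bump_eq_0: "m > 0 \<Longrightarrow> x \<notin> box a b \<Longrightarrow> box_bump a b m x = 0"
  unfolding box_bump_def mem_box
  by (rule prod_zero) (auto simp: flat_def zero_less_mult_iff)

lemma box_bump_bounds: "0 \<le> box_bump a b m x" "box_bump a b m x \<le> 1"
  unfolding box_bump_def
  by (auto intro!: prod_nonneg prod_le_1 mult_le_one flat_1_bounds mult_nonneg_nonneg)

lemma flat_1_tendsto_1:
  assumes "t > 0"
  shows "(\<lambda>n. flat 1 (real (Suc n) * t)) \<longlonglongrightarrow> 1"
proof -
  have "(\<lambda>n. exp (- (inverse (real (Suc n)) * (1 / t)))) \<longlonglongrightarrow> exp (- (0 * (1 / t)))"
    by (intro tendsto_intros LIMSEQ_inverse_real_of_nat)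
  then show ?thesis
    using assms by (simp add: flat_def field_simps del: of_nat_Suc)
qed

lemma box_bump_tendsto_indicator:
  "(\<lambda>n. box_bump a b (real (Suc n)) x) \<longlonglongrightarrow> indicator (box a b) x"
proof (cases "x \<in> box a b")
  case True
  have "(\<lambda>n. box_bump a b (real (Suc n)) x) \<longlonglongrightarrow> (\<Prod>i\<in>(Basis::'a set). 1 * 1)"
    unfolding box_bump_def
    by (intro tendsto_prod tendsto_mult flat_1_tendsto_1) (use True in \<open>auto simp: mem_box\<close>)
  with True show ?thesis by simp
next
  case False
  then show ?thesis by (simp add: box_bump_eq_0 del: of_nat_Suc)
qed

lemma box_bump_test_function:
  assumes "m > 0"
  shows "box_bump a b m \<in> test_functions"
proof -
  have "C_diff k (box_bump a b m)" for k
    unfolding box_bump_def[abs_def]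
    by (intro C_diff_prod C_diff_mult C_diff_flat C_diff_add C_diff_const C_diff_inner)
  moreover have "closure {x. box_bump a b m x \<noteq> 0} \<subseteq> cbox a b"
    by (intro closure_minimal) (use box_bump_eq_0[OF assms, of _ a b] box_subset_cbox[of a b] in auto)
  then have "compact (closure {x. box_bump a b m x \<noteq> 0})"
    using compact_closure bounded_subset[OF bounded_cbox] closure_subset by (metis (no_types, lifting) subset_trans)
  ultimately show ?thesis by (simp add: test_functions_def)
qed

lemma test_function_properties:
  assumes "\<phi> \<in> test_functions"
  shows "\<phi> \<in> borel_measurable borel" "integrable lborel (\<lambda>x. (\<phi> x)\<^sup>2)"
proof -
  have c: "continuous_on UNIV \<phi>" and K: "compact (closure {x. \<phi> x \<noteq> 0})"
    using assms C_diff_imp_continuous by (auto simp: test_functions_def)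
  show "\<phi> \<in> borel_measurable borel"
    using c by (rule borel_measurable_continuous_onI)
  have "integrable lborel (\<lambda>x. indicator (closure {x. \<phi> x \<noteq> 0}) x *\<^sub>R (\<phi> x)\<^sup>2)"
    using K by (rule borel_integrable_compact) (intro continuous_intros continuous_on_subset[OF c], simp)
  also have "(\<lambda>x. indicator (closure {x. \<phi> x \<noteq> 0}) x *\<^sub>R (\<phi> x)\<^sup>2) = (\<lambda>x. (\<phi> x)\<^sup>2)"
    using closure_subset[of "{x. \<phi> x \<noteq> 0}"] by (force simp: fun_eq_iff indicator_def)
  finally show "integrable lborel (\<lambda>x. (\<phi> x)\<^sup>2)" .
qed

subsection \<open>Uniqueness of the weak gradient\<close>

text \<open>Test with bumps of sharpness \<open>Suc n\<close>, which is always positive. They lie in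
  [0,1] and vanish off the box, so \<open>h\<close> cut off to the box dominates and the limit
  passes under the integral.\<close>

lemma set_integral_box_eq_0:
  fixes h :: "'a::euclidean_space \<Rightarrow> real"
  assumes "set_integrable lborel (box a b) h"
    and test: "\<And>\<phi>. \<phi> \<in> test_functions \<Longrightarrow> (LINT x|lborel. h x * \<phi> x) = 0"
    and [measurable]: "h \<in> borel_measurable borel"
  shows "(LINT x:box a b|lborel. h x) = 0"
proof -
  have [measurable]: "box_bump a b (real (Suc n)) \<in> borel_measurable borel" for n
    by (intro test_function_properties box_bump_test_function) simp
  have "(\<lambda>n. LINT x|lborel. h x * box_bump a b (real (Suc n)) x)
      \<longlonglongrightarrow> (LINT x|lborel. h x * indicator (box a b) x)"
  proof (rule integral_dominated_convergence[where w = "\<lambda>x. \<bar>indicator (box a b) x * h x\<bar>"])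
    show "integrable lborel (\<lambda>x. \<bar>indicator (box a b) x * h x\<bar>)"
      using assms(1) by (simp add: set_integrable_def)
    show "AE x in lborel. (\<lambda>n. h x * box_bump a b (real (Suc n)) x) \<longlonglongrightarrow> h x * indicator (box a b) x"
      by (intro always_eventually allI tendsto_mult tendsto_const box_bump_tendsto_indicator)
    show "AE x in lborel. norm (h x * box_bump a b (real (Suc n)) x) \<le> \<bar>indicator (box a b) x * h x\<bar>" for n
    proof (intro always_eventually allI)
      fix x
      show "norm (h x * box_bump a b (real (Suc n)) x) \<le> \<bar>indicator (box a b) x * h x\<bar>"
        using box_bump_bounds[of a b "real (Suc n)" x] box_bump_eq_0[of "real (Suc n)" x a b]
        by (cases "x \<in> box a b") (auto simp: abs_mult mult_left_le simp del: of_nat_Suc)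
    qed
  qed (simp_all del: of_nat_Suc)
  then have "(LINT x|lborel. h x * indicator (box a b) x) = 0"
    using test[OF box_bump_test_function] by (simp add: LIMSEQ_const_iff del: of_nat_Suc)
  then show ?thesis
    by (simp add: set_lebesgue_integral_def mult.commute)
qed

text \<open>The fundamental lemma of the calculus of variations. Boxes are an intersection-stable
  generator of the Borel sets, so a Dynkin induction carries vanishing integrals from boxes to all
  Borel sets.\<close>

lemma AE_eq_0_if_test_integrals_eq_0:
  fixes h :: "'a::euclidean_space \<Rightarrow> real"
  assumes int: "\<And>a b. set_integrable lborel (box a b) h"
    and test: "\<And>\<phi>. \<phi> \<in> test_functions \<Longrightarrow> (LINT x|lborel. h x * \<phi> x) = 0"
    and [measurable]: "h \<in> borel_measurable borel"
  shows "AE x in lborel. h x = 0"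
proof -
  \<comment> \<open>Local integrability of \<open>h\<close> becomes integrability after cutting off
    to a fixed box.\<close>
  have zero: "AE x in lborel. indicator (box a b) x * h x = 0" for a b
  proof (rule sigma_finite_measure.density_zero[OF sigma_finite_lborel])
    let ?f = "\<lambda>x. indicator (box a b) x * h x"
    show f: "integrable lborel ?f"
      using int by (simp add: set_integrable_def)
    fix A :: "'a set" assume "A \<in> sets lborel"
    then have A: "A \<in> sigma_sets UNIV (range (\<lambda>(a, b). box a b))"
      by (simp add: borel_eq_box)
    have "Int_stable (range (\<lambda>(a, b). box a b :: 'a set))"
      by (auto simp: Int_stable_def box_Int_box)
    moreover have "range (\<lambda>(a, b). box a b :: 'a set) \<subseteq> Pow UNIV"
      by auto
    moreover note A
    ultimately show "set_lebesgue_integral lborel A ?f = 0"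
    proof (induction rule: sigma_sets_induct_disjoint)
      case (basic A)
      then obtain c d where A: "A = box c d" by auto
      obtain a' b' where ab: "box c d \<inter> box a b = box a' b'"
        unfolding box_Int_box by blast
      have "set_lebesgue_integral lborel A ?f = (LINT x:box a' b'|lborel. h x)"
        unfolding set_lebesgue_integral_def A ab[symmetric] by (simp add: indicator_inter_arith mult.assoc)
      then show ?case
        using set_integral_box_eq_0[OF int test] by simp
    next
      case empty
      then show ?case by (simp add: set_lebesgue_integral_def)
    next
      case (compl A)
      have A: "A \<in> sets lborel" using compl by (simp add: borel_eq_box)
      have "set_lebesgue_integral lborel (UNIV - A) ?f = integral\<^sup>L lborel ?f - set_lebesgue_integral lborel A ?f"
        using integrable_mult_indicator[OF A f]
        unfolding set_lebesgue_integral_def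
        by (subst Bochner_Integration.integral_diff[symmetric, OF f])
          (auto intro!: Bochner_Integration.integral_cong split: split_indicator)
      \<comment> \<open>The total integral of the cut-off function is that of \<open>h\<close> over
        \<open>box a b\<close>, again a box.\<close>
      also have "integral\<^sup>L lborel ?f = 0"
        using set_integral_box_eq_0[OF int test, of a b] by (simp add: set_lebesgue_integral_def)
      finally show ?case using compl by simp
    next
      case (union A)
      have A: "range A \<subseteq> sets lborel" using union by (auto simp: borel_eq_box)
      then have "set_integrable lborel (\<Union>i. A i) ?f"
        using integrable_mult_indicator[OF _ f, of "\<Union>i. A i"] by (auto simp: set_integrable_def)
      then have "set_lebesgue_integral lborel (\<Union>i. A i) ?f = (\<Sum>i. set_lebesgue_integral lborel (A i) ?f)"
        using A union by (intro lebesgue_integral_countable_add) (auto simp: disjoint_family_on_def)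
      then show ?case using union by simp
    qed
  qed
  \<comment> \<open>Countably many boxes exhaust the space, so the exceptional null sets can be
    united.\<close>
  have "AE x in lborel. \<forall>n. indicator (box (- (real n *\<^sub>R One)) (real n *\<^sub>R One)) x * h x = 0"
    by (intro AE_all_countable[THEN iffD2] allI zero)
  then show ?thesis
  proof eventually_elim
    case (elim x)
    obtain n where "x \<in> box (- (real n *\<^sub>R One)) (real n *\<^sub>R One)"
      using UN_box_eq_UNIV by blast
    with elim show ?case by (metis indicator_simps(1) mult_1)
  qed
qed

lemma L2_measurable: "u \<in> L2 \<Longrightarrow> u \<in> borel_measurable borel"
  by (simp add: L2_def)

lemma integrable_mult_of_squares:
  fixes f g :: "'a \<Rightarrow> real"
  assumes [measurable]: "f \<in> borel_measurable M" "g \<in> borel_measurable M"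
    and "integrable M (\<lambda>x. (f x)\<^sup>2)" "integrable M (\<lambda>x. (g x)\<^sup>2)"
  shows "integrable M (\<lambda>x. f x * g x)"
proof (rule Bochner_Integration.integrable_bound)
  show "integrable M (\<lambda>x. (f x)\<^sup>2 + (g x)\<^sup>2)"
    using assms by simp
  have "\<bar>f x * g x\<bar> \<le> (f x)\<^sup>2 + (g x)\<^sup>2" for x
  proof -
    have "2 * \<bar>f x * g x\<bar> \<le> (f x)\<^sup>2 + (g x)\<^sup>2"
      using sum_squares_bound[of "\<bar>f x\<bar>" "\<bar>g x\<bar>"] by (simp add: abs_mult)
    then show ?thesis
      using abs_ge_zero[of "f x * g x"] by linarith
  qed
  then show "AE x in M. norm (f x * g x) \<le> norm ((f x)\<^sup>2 + (g x)\<^sup>2)"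
    by (intro always_eventually allI) simp
qed simp

lemma L2_component:
  fixes g :: "'a::euclidean_space \<Rightarrow> 'b::euclidean_space"
  assumes "g \<in> L2" "b \<in> Basis"
  shows "integrable lborel (\<lambda>x. (g x \<bullet> b)\<^sup>2)"
proof (rule Bochner_Integration.integrable_bound)
  show "integrable lborel (\<lambda>x. (norm (g x))\<^sup>2)"
    using assms by (simp add: L2_def)
  show "(\<lambda>x. (g x \<bullet> b)\<^sup>2) \<in> borel_measurable lborel"
    using L2_measurable[OF assms(1)] by simp
  show "AE x in lborel. norm ((g x \<bullet> b)\<^sup>2) \<le> norm ((norm (g x))\<^sup>2)"
    using Basis_le_norm[OF assms(2)] by (auto simp: abs_le_square_iff[symmetric])
qed

text \<open>Each component of the difference integrates to 0 against all test functions. This makes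
  the arbitrary choice in \<open>weak_gradient\<close> harmless: an explicit candidate agrees with
  it almost everywhere.\<close>

lemma weak_gradient_unique:
  assumes g: "g \<in> L2" "has_weak_gradient u g" and g': "g' \<in> L2" "has_weak_gradient u g'"
  shows "AE x in lborel. g x = g' x"
proof -
  note [measurable] = L2_measurable[OF g(1)] L2_measurable[OF g'(1)]
  have "AE x in lborel. g x \<bullet> b - g' x \<bullet> b = 0" if b: "b \<in> Basis" for b
  proof (rule AE_eq_0_if_test_integrals_eq_0)
    have I: "integrable lborel (\<lambda>x. (g x \<bullet> b) * \<psi> x)" "integrable lborel (\<lambda>x. (g' x \<bullet> b) * \<psi> x)"
      if [measurable]: "\<psi> \<in> borel_measurable borel" and "integrable lborel (\<lambda>x. (\<psi> x)\<^sup>2)" for \<psi> :: "'a \<Rightarrow> real"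
      using that b g g' by (auto intro!: integrable_mult_of_squares L2_component)
    show "set_integrable lborel (box c d) (\<lambda>x. g x \<bullet> b - g' x \<bullet> b)" for c d
    proof -
      \<comment> \<open>Pairing with the square integrable indicator of a bounded box gives local
        integrability.\<close>
      have "integrable lborel (\<lambda>x. (indicator (box c d) x :: real)\<^sup>2)"
        by (simp add: power2_eq_square indicator_inter_arith[symmetric] integrable_real_indicator
              emeasure_lborel_box_eq)
      from I[OF _ this] show ?thesis
        by (simp add: set_integrable_def right_diff_distrib mult.commute)
    qed
    show "(LINT x|lborel. (g x \<bullet> b - g' x \<bullet> b) * \<phi> x) = 0" if "\<phi> \<in> test_functions" for \<phi>
      using g(2) g'(2) b that I[OF test_function_properties[OF that]]
      by (simp add: has_weak_gradient_def left_diff_distrib)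
  qed simp
  then have "AE x in lborel. \<forall>b\<in>Basis. g x \<bullet> b - g' x \<bullet> b = 0"
    by (intro AE_finite_allI) auto
  then show ?thesis
    by eventually_elim (auto intro: euclidean_eqI)
qed

lemma weak_gradient_H1:
  assumes "u \<in> H1"
  shows "weak_gradient u \<in> L2" "has_weak_gradient u (weak_gradient u)"
proof -
  have "\<exists>g. g \<in> L2 \<and> has_weak_gradient u g"
    using assms by (auto simp: H1_def)
  from someI_ex[OF this] show "weak_gradient u \<in> L2" "has_weak_gradient u (weak_gradient u)"
    by (auto simp: weak_gradient_def)
qed

section \<open>Homogeneity of the norms\<close>

lemma has_weak_gradient_scale:
  "has_weak_gradient u g \<Longrightarrow> has_weak_gradient (\<lambda>x. c * u x) (\<lambda>x. c *\<^sub>R g x)"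
  by (simp add: has_weak_gradient_def mult.assoc)

lemma L2_scale: "u \<in> L2 \<Longrightarrow> (\<lambda>x. c *\<^sub>R u x) \<in> L2"
  by (auto simp: L2_def power_mult_distrib intro!: borel_measurable_scaleR)

lemma H1_scale: "u \<in> H1 \<Longrightarrow> (\<lambda>x. c * u x) \<in> H1"
  unfolding H1_def using L2_scale[of u c] by (auto intro: has_weak_gradient_scale L2_scale)

lemma weak_gradient_scale:
  assumes "u \<in> H1"
  shows "AE x in lborel. weak_gradient (\<lambda>x. c * u x) x = c *\<^sub>R weak_gradient u x"
  using weak_gradient_H1[OF assms] weak_gradient_H1[OF H1_scale[OF assms]]
  by (intro weak_gradient_unique[of _ "\<lambda>x. c * u x"] L2_scale has_weak_gradient_scale)

lemma weak_gradient_energy_scale: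
  assumes "u \<in> H1"
  shows "(LINT x|lborel. (norm (weak_gradient (\<lambda>x. c * u x) x))\<^sup>2) =
    c\<^sup>2 * (LINT x|lborel. (norm (weak_gradient u x))\<^sup>2)"
proof -
  note [measurable] = L2_measurable[OF weak_gradient_H1(1)[OF assms]]
    L2_measurable[OF weak_gradient_H1(1)[OF H1_scale[OF assms, of c]]]
  have "(LINT x|lborel. (norm (weak_gradient (\<lambda>x. c * u x) x))\<^sup>2) =
      (LINT x|lborel. c\<^sup>2 * (norm (weak_gradient u x))\<^sup>2)"
    using weak_gradient_scale[OF assms, of c]
    by (intro integral_cong_AE) (auto simp: power_mult_distrib)
  then show ?thesis by simp
qed

lemma H1_norm_scale: "u \<in> H1 \<Longrightarrow> H1_norm (\<lambda>x. c * u x) = \<bar>c\<bar> * H1_norm u"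
  by (simp add: H1_norm_def weak_gradient_energy_scale power_mult_distrib real_sqrt_mult
        flip: distrib_left)

text \<open>Pulling \<open>c\<^sup>2\<close> out of the double integral is legitimate even if it
  diverges, since the Bochner integral is then 0 by convention.\<close>

lemma norm_s_sq_scale:
  assumes "u \<in> H1"
  shows "norm_s_sq s (\<lambda>x. c * u x) = c\<^sup>2 * norm_s_sq s u"
proof -
  have "(\<lambda>(x, y). \<bar>c * u x - c * u y\<bar>\<^sup>2 / norm (x - y) powr (real DIM('a) + 2 * s)) =
     (\<lambda>z. c\<^sup>2 * (case z of (x, y) \<Rightarrow> \<bar>u x - u y\<bar>\<^sup>2 / norm (x - y) powr (real DIM('a) + 2 * s)))"
    by (auto simp: fun_eq_iff power_mult_distrib abs_mult simp flip: right_diff_distrib)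
  then show ?thesis
    using assms by (simp add: norm_s_sq_def weak_gradient_energy_scale power_mult_distrib distrib_left)
qed

lemma H1_norm_nonneg: "0 \<le> H1_norm u"
  by (simp add: H1_norm_def)

lemma H1_norm_sq_le_norm_s_sq: "(H1_norm u)\<^sup>2 \<le> norm_s_sq s u"
  unfolding H1_norm_def norm_s_sq_def
  by (auto intro!: Bochner_Integration.integral_nonneg)

lemma L2_integral_le_H1_norm_sq: "(LINT x|lborel. (u x)\<^sup>2) \<le> (H1_norm u)\<^sup>2"
  by (simp add: H1_norm_def)

subsection \<open>The functional along rays\<close>

text \<open>As a Bochner integral this is 0 when the power is not integrable, a case that has to be
  excluded for the Palais-Smale sequence.\<close>

definition pos_power_integral :: "real \<Rightarrow> ('a::euclidean_space \<Rightarrow> real) \<Rightarrow> real" where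
  "pos_power_integral q u = (LINT x|lborel. max (u x) 0 powr q)"

lemma pos_power_integral_nonneg: "0 \<le> pos_power_integral q u"
  by (simp add: pos_power_integral_def)

lemma F_plus_eq: "F_plus s p u = norm_s_sq s u / 2 - pos_power_integral (p + 1) u / (p + 1)"
  by (simp add: F_plus_def pos_power_integral_def)

lemma F_plus_scale:
  assumes "u \<in> H1" "0 \<le> c"
  shows "F_plus s p (\<lambda>x. c * u x) =
    c\<^sup>2 / 2 * norm_s_sq s u - c powr (p + 1) / (p + 1) * pos_power_integral (p + 1) u"
proof -
  have "max (c * u x) 0 = c * max (u x) 0" for x
    using assms(2) max_mult_distrib_left[of c "u x" 0] by simp
  then show ?thesis
    using assms by (simp add: F_plus_eq norm_s_sq_scale pos_power_integral_def powr_mult)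
qed

section \<open>The gradient paired with its base point\<close>

lemma H1_dual_scale:
  assumes "L \<in> H1_dual" "u \<in> H1"
  shows "L (\<lambda>x. c * u x) = c * L u"
proof -
  have "L (\<lambda>x. c * u x + 0 * u x) = c * L u + 0 * L u"
    using assms unfolding H1_dual_def by blast
  then show ?thesis by simp
qed

lemma H1_dual_norm_bound:
  assumes L: "L \<in> H1_dual" and u: "u \<in> H1"
  shows "\<bar>L u\<bar> \<le> H1_dual_norm L * H1_norm u"
proof -
  obtain C where C: "\<And>v. v \<in> H1 \<Longrightarrow> \<bar>L v\<bar> \<le> C * H1_norm v"
    using L unfolding H1_dual_def by blast
  show ?thesis
  proof (cases "H1_norm u = 0")
    \<comment> \<open>A function of zero norm cannot be normalised; the continuity bound with
      \<open>C\<close> settles it.\<close>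
    case True
    with C[OF u] show ?thesis by simp
  next
    case False
    define h where "h = H1_norm u"
    have h: "h > 0" using False H1_norm_nonneg[of u] by (simp add: h_def)
    let ?B = "{\<phi>\<in>H1. H1_norm \<phi> \<le> 1}"
    \<comment> \<open>The real-valued supremum dominates its members only once they are known to be
      bounded above.\<close>
    have "\<bar>L v\<bar> \<le> \<bar>C\<bar>" if "v \<in> ?B" for v
    proof -
      have "\<bar>L v\<bar> \<le> \<bar>C\<bar> * H1_norm v"
        using C[of v] that mult_right_mono[OF abs_ge_self H1_norm_nonneg, of C v] by simp
      also have "\<dots> \<le> \<bar>C\<bar>"
        using that by (auto intro: mult_left_le)
      finally show ?thesis .
    qed
    then have "bdd_above ((\<lambda>v. \<bar>L v\<bar>) ` ?B)"
      by (intro bdd_aboveI2)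
    moreover have "(\<lambda>x. 1 / h * u x) \<in> ?B"
      using H1_scale[OF u, of "1 / h"] H1_norm_scale[OF u, of "1 / h"] h
      by (simp add: h_def[symmetric])
    ultimately have "\<bar>L (\<lambda>x. 1 / h * u x)\<bar> \<le> H1_dual_norm L"
      unfolding H1_dual_norm_def by (intro cSUP_upper)
    then show ?thesis
      using h unfolding H1_dual_scale[OF L u] by (simp add: abs_mult h_def[symmetric] field_simps)
  qed
qed

text \<open>Differentiate \<open>F_plus\<close> at \<open>(1 + t) u\<close> in t = 0 in two ways:
  the gradient yields \<open>L u\<close>, the homogeneity formula yields the right-hand
  side.\<close>

lemma has_H1_gradient_at_self:
  assumes u: "u \<in> H1" and L: "has_H1_gradient (F_plus s p) u L" and p: "p > 0"
  shows "L u = norm_s_sq s u - pos_power_integral (p + 1) u"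
proof -
  have LD: "L \<in> H1_dual" using L by (simp add: has_H1_gradient_def)
  let ?f = "\<lambda>t. F_plus s p (\<lambda>x. (1 + t) * u x)"
  \<comment> \<open>The added 1 keeps the divisor positive even if the norm vanishes.\<close>
  define h where "h = H1_norm u + 1"
  have h: "h > 0" "H1_norm u \<le> h" using H1_norm_nonneg[of u] by (auto simp: h_def)
  have "(?f has_derivative (\<lambda>t. t * L u)) (at 0)"
    unfolding has_derivative_at_alt
  proof (intro conjI allI impI)
    show "bounded_linear (\<lambda>t. t * L u)" by (rule bounded_linear_mult_left)
    fix e :: real assume e: "e > 0"
    have "e / h > 0" using e h by simp
    then obtain \<delta> where \<delta>: "\<delta> > 0" and bound: "\<And>\<phi>. \<phi> \<in> H1 \<Longrightarrow> H1_norm \<phi> < \<delta> \<Longrightarrow>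
        \<bar>F_plus s p (\<lambda>x. u x + \<phi> x) - F_plus s p u - L \<phi>\<bar> \<le> e / h * H1_norm \<phi>"
      using L unfolding has_H1_gradient_def by meson
    show "\<exists>d>0. \<forall>t. norm (t - 0) < d \<longrightarrow> norm (?f t - ?f 0 - (t - 0) * L u) \<le> e * norm (t - 0)"
    proof (intro exI[of _ "\<delta> / h"] conjI allI impI)
      show "\<delta> / h > 0" using \<delta> h by simp
      fix t :: real assume t: "norm (t - 0) < \<delta> / h"
      have le: "H1_norm (\<lambda>x. t * u x) \<le> \<bar>t\<bar> * h"
        using h by (simp add: H1_norm_scale[OF u] mult_left_mono)
      also have "\<dots> < \<delta>" using t h by (simp add: pos_less_divide_eq)
      finally have "\<bar>F_plus s p (\<lambda>x. u x + t * u x) - F_plus s p u - L (\<lambda>x. t * u x)\<bar>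
          \<le> e / h * H1_norm (\<lambda>x. t * u x)"
        by (intro bound H1_scale[OF u])
      also have "\<dots> \<le> e / h * (\<bar>t\<bar> * h)"
        using le e h by (intro mult_left_mono) auto
      also have "\<dots> = e * \<bar>t\<bar>" using h by simp
      finally show "norm (?f t - ?f 0 - (t - 0) * L u) \<le> e * norm (t - 0)"
        by (simp add: H1_dual_scale[OF LD u] distrib_right)
    qed
  qed
  then have 1: "(?f has_real_derivative L u) (at 0)"
    by (simp add: has_field_derivative_def mult.commute[of _ "L u"])
  have "((\<lambda>t. (1 + t)\<^sup>2 / 2 * norm_s_sq s u - (1 + t) powr (p + 1) / (p + 1) * pos_power_integral (p + 1) u)
      has_real_derivative norm_s_sq s u - pos_power_integral (p + 1) u) (at 0)"
    using p by (auto intro!: derivative_eq_intros)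
  \<comment> \<open>The ray formula requires \<open>1 + t\<close> to be nonnegative, hence the
    neighbourhood above -1.\<close>
  then have "(?f has_real_derivative norm_s_sq s u - pos_power_integral (p + 1) u) (at 0)"
    by (rule has_field_derivative_transform_within_open[where S = "{-1<..}"])
      (auto simp: F_plus_scale[OF u])
  with 1 show ?thesis by (rule DERIV_unique)
qed

section \<open>The ray as a mountain pass path\<close>

lemma fibre_map_le:
  fixes t p :: real
  assumes "0 \<le> t" "1 < p"
  shows "t\<^sup>2 / 2 - t powr (p + 1) / (p + 1) \<le> 1 / 2 - 1 / (p + 1)"
proof (cases "t = 0")
  case True
  with assms show ?thesis by simp
next
  case False
  \<comment> \<open>Young's inequality for \<open>t powr (p + 1)\<close> and 1, with weights chosen
    so that the left side is \<open>t\<^sup>2\<close>.\<close>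
  have "(t powr (p + 1)) powr (2 / (p + 1)) * 1 powr (1 - 2 / (p + 1))
      \<le> 2 / (p + 1) * t powr (p + 1) + (1 - 2 / (p + 1)) * 1"
    using assms False by (intro Youngs_inequality_0) auto
  moreover have "(t powr (p + 1)) powr (2 / (p + 1)) = t powr 2"
  proof -
    have "(p + 1) * (2 / (p + 1)) = 2" using assms by (simp add: divide_eq_eq)
    then show ?thesis by (simp only: powr_powr)
  qed
  ultimately have "t\<^sup>2 \<le> 2 / (p + 1) * t powr (p + 1) + (1 - 2 / (p + 1))"
    using assms False by simp
  then show ?thesis by (simp add: field_simps)
qed

lemma mountain_pass_level_le:
  fixes w :: "'a::euclidean_space \<Rightarrow> real"
  assumes w: "w \<in> H1" and nehari: "norm_s_sq s w = pos_power_integral (p + 1) w"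
    and pos: "pos_power_integral (p + 1) w > 0" and p: "1 < p"
  shows "mountain_pass_level (F_plus s p :: ('a \<Rightarrow> real) \<Rightarrow> real) \<le> ereal (F_plus s p w)"
proof -
  define P where "P = pos_power_integral (p + 1) w"
  have F: "F_plus s p (\<lambda>x. t * w x) = P * (t\<^sup>2 / 2 - t powr (p + 1) / (p + 1))" if "0 \<le> t" for t
    using that by (simp add: F_plus_scale[OF w] nehari P_def algebra_simps)
  \<comment> \<open>\<open>T\<close> solves \<open>T powr (p - 1) = p + 1\<close>, which makes the
    value at the end of the path \<open>- P * T\<^sup>2 / 2\<close>, hence negative.\<close>
  define T where "T = (p + 1) powr (1 / (p - 1))"
  have T: "T > 0" using p by (simp add: T_def)
  define \<gamma> where "\<gamma> t = (\<lambda>x. t * T * w x)" for t :: real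
  have "T powr (p + 1) = T powr (p - 1) * T powr 2"
    by (simp add: add.commute flip: powr_add)
  moreover have "T powr (p - 1) = p + 1"
    using p by (simp add: T_def powr_powr)
  ultimately have "T powr (p + 1) = (p + 1) * T\<^sup>2"
    using T by simp
  then have "F_plus s p (\<gamma> 1) = P * (- T\<^sup>2 / 2)"
    using F[of T] p T by (simp add: \<gamma>_def)
  also have "\<dots> < 0"
    using pos T unfolding P_def by (intro mult_pos_neg) auto
  finally have neg: "F_plus s p (\<gamma> 1) < 0" .
  have cont: "((\<lambda>r. H1_norm (\<lambda>x. \<gamma> r x - \<gamma> t x)) \<longlongrightarrow> 0) (at t within {0..1})" for t
  proof -
    have "(\<lambda>x. \<gamma> r x - \<gamma> t x) = (\<lambda>x. (r - t) * T * w x)" for r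
      by (auto simp: \<gamma>_def algebra_simps)
    then have "H1_norm (\<lambda>x. \<gamma> r x - \<gamma> t x) = \<bar>(r - t) * T\<bar> * H1_norm w" for r
      by (simp add: H1_norm_scale[OF w])
    moreover have "((\<lambda>r. \<bar>(r - t) * T\<bar> * H1_norm w) \<longlongrightarrow> \<bar>(t - t) * T\<bar> * H1_norm w) (at t within {0..1})"
      by (intro tendsto_intros)
    ultimately show ?thesis by simp
  qed
  have "\<gamma> \<in> mountain_pass_paths (F_plus s p)"
    using neg cont by (auto simp: mountain_pass_paths_def H1_scale[OF w] \<gamma>_def)
  then have "mountain_pass_level (F_plus s p :: ('a \<Rightarrow> real) \<Rightarrow> real) \<le> (SUP t\<in>{0..1}. ereal (F_plus s p (\<gamma> t)))"
    unfolding mountain_pass_level_def by (rule INF_lower)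
  also have "\<dots> \<le> ereal (F_plus s p w)"
  proof (rule SUP_least)
    fix t :: real assume "t \<in> {0..1}"
    then have "0 \<le> t * T" using T by simp
    then have "F_plus s p (\<gamma> t) \<le> P * (1 / 2 - 1 / (p + 1))"
      unfolding \<gamma>_def using pos p by (subst F) (auto intro!: mult_left_mono fibre_map_le simp: P_def)
    also have "\<dots> = F_plus s p w"
      using F[of 1] by simp
    finally show "ereal (F_plus s p (\<gamma> t)) \<le> ereal (F_plus s p w)" by simp
  qed
  finally show ?thesis .
qed

subsection \<open>Lower semicontinuity under local convergence\<close>

text \<open>Convexity of the power at \<open>a / l\<close> and \<open>b / (1 - l)\<close> with
  weights \<open>l\<close> and \<open>1 - l\<close>. The coefficient of \<open>a\<close> tends to 1
  as \<open>l\<close> tends to 1, at the expense of the one of \<open>b\<close>.\<close>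

lemma powr_add_le_weighted:
  fixes a b l q :: real
  assumes "0 \<le> a" "0 \<le> b" "0 < l" "l < 1" "1 \<le> q"
  shows "(a + b) powr q \<le> l powr (1 - q) * a powr q + (1 - l) powr (1 - q) * b powr q"
proof -
  have ge1: "m powr (1 - q) \<ge> 1" if "0 < m" "m < 1" for m
    using that assms powr_mono'[of "1 - q" 0 m] by simp
  consider "a = 0" | "b = 0" | "a > 0" "b > 0" using assms by linarith
  then show ?thesis
  proof cases
    case 1
    then show ?thesis using ge1[of "1 - l"] assms by (simp add: mult_le_cancel_right1)
  next
    case 2
    then show ?thesis using ge1[of l] assms by (simp add: mult_le_cancel_right1)
  next
    case 3
    have scale: "m * (c / m) powr q = m powr (1 - q) * c powr q" if "0 < m" "0 < c" for m c
      using that by (simp add: powr_divide powr_diff)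
    have "(l * (a / l) + (1 - l) * (b / (1 - l))) powr q
        \<le> l * (a / l) powr q + (1 - l) * (b / (1 - l)) powr q"
      using convex_onD[OF powr_convex[OF assms(5)], of "1 - l" "a / l" "b / (1 - l)"] 3 assms by simp
    then show ?thesis
      using assms 3 scale[of l a] scale[of "1 - l" b] by simp
  qed
qed

text \<open>Closed balls exhaust the space, and the measure with density \<open>f\<close> is
  continuous from below.\<close>

lemma nn_integral_le_if_le_on_compacts:
  fixes f :: "'a::euclidean_space \<Rightarrow> ennreal"
  assumes [measurable]: "f \<in> borel_measurable borel"
    and "\<And>K. compact K \<Longrightarrow> (\<integral>\<^sup>+x\<in>K. f x \<partial>lborel) \<le> C"
  shows "(\<integral>\<^sup>+x. f x \<partial>lborel) \<le> C"
proof -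
  let ?D = "density lborel f"
  have "(\<Union>n. cball 0 (real n)) = (UNIV :: 'a set)"
    using real_arch_simple by auto
  then have "(\<integral>\<^sup>+x. f x \<partial>lborel) = emeasure ?D (\<Union>n. cball 0 (real n))"
    by (simp add: emeasure_density)
  also have "\<dots> = (SUP n. emeasure ?D (cball 0 (real n)))"
    by (intro SUP_emeasure_incseq[symmetric]) (auto simp: incseq_def)
  also have "\<dots> \<le> C"
    using assms(2)[of "cball 0 _"] by (intro SUP_least) (simp add: emeasure_density)
  finally show ?thesis .
qed

text \<open>The map \<tau> is later the identity or the positive part. For each tolerance a single
  index \<open>k\<close> with small local error is enough, so the bound is asked only infinitely
  often.\<close>

lemma Lq_loc_lower_semicontinuous:
  fixes w :: "'a::euclidean_space \<Rightarrow> real"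
  assumes q: "1 < q" and conv: "Lq_loc_converges q v w"
    and \<tau>: "\<And>a b. \<bar>\<tau> a\<bar> \<le> \<bar>\<tau> b\<bar> + \<bar>a - b\<bar>" and [measurable]: "\<tau> \<in> borel_measurable borel"
    and bound: "\<And>e. e > 0 \<Longrightarrow> \<exists>\<^sub>F k in sequentially.
        (\<integral>\<^sup>+x. ennreal (\<bar>\<tau> (v k x)\<bar> powr q) \<partial>lborel) \<le> ennreal (A + e)"
    and A: "0 \<le> A"
  shows "(\<integral>\<^sup>+x. ennreal (\<bar>\<tau> (w x)\<bar> powr q) \<partial>lborel) \<le> ennreal A"
proof (rule nn_integral_le_if_le_on_compacts)
  have [measurable]: "w \<in> borel_measurable borel" "v k \<in> borel_measurable borel" for k
    using conv by (auto simp: Lq_loc_converges_def Lq_loc_def)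
  show "(\<lambda>x. ennreal (\<bar>\<tau> (w x)\<bar> powr q)) \<in> borel_measurable borel" by measurable
  fix K :: "'a set" assume K: "compact K"
  then have [measurable]: "K \<in> sets borel" by (rule borel_compact)
  let ?I = "\<integral>\<^sup>+x\<in>K. ennreal (\<bar>\<tau> (w x)\<bar> powr q) \<partial>lborel"
  \<comment> \<open>The tolerance \<open>(1 - l) powr q\<close> serves for both the excess over
    \<open>A\<close> and the local error. It turns the last summand into \<open>1 - l\<close>, so
    \<open>R l\<close> tends to \<open>A\<close> as \<open>l\<close> tends to 1.\<close>
  define R where "R l = l powr (1 - q) * (A + (1 - l) powr q) + (1 - l) powr (1 - q) * (1 - l) powr q" for l :: real
  have step: "?I \<le> ennreal (R l)" if l: "0 < l" "l < 1" for l
  proof -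
    have e: "(1 - l) powr q > 0" using l by simp
    have "(\<lambda>k. \<integral>\<^sup>+x\<in>K. ennreal (\<bar>v k x - w x\<bar> powr q) \<partial>lborel) \<longlonglongrightarrow> 0"
      using conv K by (simp add: Lq_loc_converges_def)
    then have "\<forall>\<^sub>F k in sequentially. (\<integral>\<^sup>+x\<in>K. ennreal (\<bar>v k x - w x\<bar> powr q) \<partial>lborel) < ennreal ((1 - l) powr q)"
      using e by (intro order_tendstoD) auto
    from frequently_eventually_frequently[OF bound[OF e] this]
    obtain k where k: "(\<integral>\<^sup>+x. ennreal (\<bar>\<tau> (v k x)\<bar> powr q) \<partial>lborel) \<le> ennreal (A + (1 - l) powr q)"
        "(\<integral>\<^sup>+x\<in>K. ennreal (\<bar>v k x - w x\<bar> powr q) \<partial>lborel) < ennreal ((1 - l) powr q)"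
      by (auto dest: frequently_ex)
    have pw: "ennreal (\<bar>\<tau> (w x)\<bar> powr q) * indicator K x
        \<le> ennreal (l powr (1 - q)) * ennreal (\<bar>\<tau> (v k x)\<bar> powr q)
          + ennreal ((1 - l) powr (1 - q)) * (ennreal (\<bar>v k x - w x\<bar> powr q) * indicator K x)" for x
    proof (cases "x \<in> K")
      case True
      have "\<bar>\<tau> (w x)\<bar> powr q \<le> (\<bar>\<tau> (v k x)\<bar> + \<bar>v k x - w x\<bar>) powr q"
        using \<tau>[of "w x" "v k x"] q by (intro powr_mono2) (auto simp: abs_minus_commute)
      also have "\<dots> \<le> l powr (1 - q) * \<bar>\<tau> (v k x)\<bar> powr q + (1 - l) powr (1 - q) * \<bar>v k x - w x\<bar> powr q"
        using l q by (intro powr_add_le_weighted) auto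
      finally show ?thesis
        using True by (simp add: ennreal_mult[symmetric] ennreal_plus[symmetric] del: ennreal_plus)
    qed simp
    have "?I \<le> (\<integral>\<^sup>+x. ennreal (l powr (1 - q)) * ennreal (\<bar>\<tau> (v k x)\<bar> powr q)
          + ennreal ((1 - l) powr (1 - q)) * (ennreal (\<bar>v k x - w x\<bar> powr q) * indicator K x) \<partial>lborel)"
      by (intro nn_integral_mono pw)
    also have "\<dots> = ennreal (l powr (1 - q)) * (\<integral>\<^sup>+x. ennreal (\<bar>\<tau> (v k x)\<bar> powr q) \<partial>lborel)
        + ennreal ((1 - l) powr (1 - q)) * (\<integral>\<^sup>+x\<in>K. ennreal (\<bar>v k x - w x\<bar> powr q) \<partial>lborel)"
      by (simp add: nn_integral_add nn_integral_cmult)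
    also have "\<dots> \<le> ennreal (l powr (1 - q)) * ennreal (A + (1 - l) powr q)
        + ennreal ((1 - l) powr (1 - q)) * ennreal ((1 - l) powr q)"
      using k by (intro add_mono mult_left_mono) auto
    also have "\<dots> = ennreal (R l)"
      using A by (simp add: R_def ennreal_mult[symmetric] ennreal_plus[symmetric] del: ennreal_plus)
    finally show ?thesis .
  qed
  have "((\<lambda>l. l powr (1 - q) * (A + (1 - l) powr q) + (1 - l)) \<longlongrightarrow> 1 powr (1 - q) * (A + (1 - 1) powr q) + (1 - 1)) (at_left 1)"
    using q by (intro tendsto_intros tendsto_powr2) (auto simp: eventually_at_filter)
  moreover have ev: "\<forall>\<^sub>F l in at_left 1. 0 < l \<and> l < (1::real)"
    using eventually_at_left_real[of 0 1] by (auto elim: eventually_mono)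
  then have "\<forall>\<^sub>F l in at_left 1. l powr (1 - q) * (A + (1 - l) powr q) + (1 - l) = R l"
    by eventually_elim (simp add: R_def powr_add[symmetric])
  ultimately have "(R \<longlongrightarrow> A) (at_left 1)"
    using Lim_transform_eventually by fastforce
  then have "((\<lambda>l. ennreal (R l)) \<longlongrightarrow> ennreal A) (at_left 1)"
    by (rule tendsto_ennrealI)
  moreover have "\<forall>\<^sub>F l in at_left 1. ?I \<le> ennreal (R l)"
    using ev by eventually_elim (use step in auto)
  ultimately show "?I \<le> ennreal A"
    by (rule tendsto_lowerbound) simp
qed

section \<open>Translation invariance and positivity\<close>

lemma nn_integral_lborel_translate:
  fixes f :: "'a::euclidean_space \<Rightarrow> ennreal"
  assumes [measurable]: "f \<in> borel_measurable borel"
  shows "(\<integral>\<^sup>+x. f (x + c) \<partial>lborel) = (\<integral>\<^sup>+x. f x \<partial>lborel)"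
proof -
  have "(\<integral>\<^sup>+x. f x \<partial>lborel) = (\<integral>\<^sup>+x. f x \<partial>distr lborel borel ((+) c))"
    by (simp add: lborel_distr_plus)
  also have "\<dots> = (\<integral>\<^sup>+x. f (c + x) \<partial>lborel)"
    by (simp add: nn_integral_distr)
  finally show ?thesis by (simp add: add.commute)
qed

lemma norm_s_sq_pos:
  assumes u: "u \<in> H1" and nontrivial: "\<not> (AE x in lborel. u x = 0)"
  shows "0 < norm_s_sq s u"
proof -
  have "integrable lborel (\<lambda>x. (u x)\<^sup>2)"
    using u by (simp add: H1_def L2_def)
  then have "(LINT x|lborel. (u x)\<^sup>2) \<noteq> 0"
    using nontrivial by (simp add: integral_nonneg_eq_0_iff_AE)
  then have "0 < (LINT x|lborel. (u x)\<^sup>2)"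
    by (simp add: order_less_le Bochner_Integration.integral_nonneg)
  then show ?thesis
    using L2_integral_le_H1_norm_sq[of u] H1_norm_sq_le_norm_s_sq[of u s] by linarith
qed

subsection \<open>The critical value\<close>

theorem corollary2p6:
  fixes s p :: real
    and u :: "nat \<Rightarrow> 'a::euclidean_space \<Rightarrow> real"
    and G :: "nat \<Rightarrow> ('a \<Rightarrow> real) \<Rightarrow> real"
    and y :: "nat \<Rightarrow> 'a"
    and ubar :: "'a \<Rightarrow> real"
  assumes n: "DIM('a) \<ge> 2"
    and s: "0 < s" "s < 1"
    and p: "1 < p" "DIM('a) > 2 \<longrightarrow> p < (real DIM('a) + 2) / (real DIM('a) - 2)"
    and critical: "H1_critical_point (F_plus s p) ubar"
    and nontrivial: "\<not> (AE x in lborel. ubar x = 0)"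
    and u_H1: "\<And>k. u k \<in> H1"
    and level: "(\<lambda>k. ereal (F_plus s p (u k))) \<longlonglongrightarrow> mountain_pass_level (F_plus s p :: ('a \<Rightarrow> real) \<Rightarrow> real)"
    and gradient: "\<And>k. has_H1_gradient (F_plus s p) (u k) (G k)"
    and gradient_to_0: "(\<lambda>k. H1_dual_norm (G k)) \<longlonglongrightarrow> 0"
    and weak: "H1_weakly_converges (\<lambda>k x. u k (x + y k)) ubar"
    and strong: "\<And>q. \<lbrakk>1 < q; ereal q < sobolev_exponent DIM('a)\<rbrakk>
                   \<Longrightarrow> Lq_loc_converges q (\<lambda>k x. u k (x + y k)) ubar"
  shows "ereal (F_plus s p ubar) = mountain_pass_level (F_plus s p :: ('a \<Rightarrow> real) \<Rightarrow> real)"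
proof -
  let ?c = "mountain_pass_level (F_plus s p :: ('a \<Rightarrow> real) \<Rightarrow> real)"
  define \<theta> where "\<theta> = 1 / 2 - 1 / (p + 1)"
  define N where "N k = norm_s_sq s (u k)" for k
  define P where "P k = pos_power_integral (p + 1) (u k)" for k
  define h where "h k = H1_norm (u k)" for k
  have \<theta>: "\<theta> > 0" using p(1) by (simp add: \<theta>_def field_simps)

  have ubar: "ubar \<in> H1" and "has_H1_gradient (F_plus s p) ubar (\<lambda>\<phi>. 0)"
    using critical by (auto simp: H1_critical_point_def)
  from has_H1_gradient_at_self[OF this] p(1)
  have nehari: "norm_s_sq s ubar = pos_power_integral (p + 1) ubar" by simp
  have Pbar: "pos_power_integral (p + 1) ubar > 0"
    using norm_s_sq_pos[OF ubar nontrivial, of s] by (simp add: nehari)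
  have Fubar: "F_plus s p ubar = \<theta> * pos_power_integral (p + 1) ubar"
    by (simp add: F_plus_eq nehari \<theta>_def algebra_simps)
  have level_le: "?c \<le> ereal (F_plus s p ubar)"
    using ubar nehari Pbar p(1) by (rule mountain_pass_level_le)

  have G_eq: "G k (u k) = N k - P k" for k
    using has_H1_gradient_at_self[OF u_H1 gradient] p(1) by (simp add: N_def P_def)
  have G_le: "\<bar>G k (u k)\<bar> \<le> H1_dual_norm (G k) * h k" for k
    using gradient u_H1 by (auto simp: h_def has_H1_gradient_def intro: H1_dual_norm_bound)
  have h: "0 \<le> h k" "(h k)\<^sup>2 \<le> N k" for k
    by (simp_all add: h_def N_def H1_norm_nonneg H1_norm_sq_le_norm_s_sq)
  \<comment> \<open>Eliminating \<open>N k\<close> expresses the energy by the power term and a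
    pairing that will tend to 0.\<close>
  have F_eq: "F_plus s p (u k) = \<theta> * P k + G k (u k) / 2" for k
    by (simp add: F_plus_eq G_eq N_def P_def \<theta>_def field_simps)

  \<comment> \<open>Any real number above the level would do; the bound by the critical value
    supplies one.\<close>
  define M where "M = F_plus s p ubar + 1"
  have "?c < ereal M"
    using level_le by (rule le_less_trans) (simp add: M_def)
  then have "\<forall>\<^sub>F k in sequentially. ereal (F_plus s p (u k)) < ereal M"
    by (rule order_tendstoD(2)[OF level])
  \<comment> \<open>With the factor \<theta>/2 the pairing is at most half of
    \<open>\<theta> * (1 + (h k)\<^sup>2)\<close> and can be absorbed on the left.\<close>
  moreover have "\<forall>\<^sub>F k in sequentially. H1_dual_norm (G k) < \<theta> / 2"
    using gradient_to_0 \<theta> by (intro order_tendstoD) auto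
  ultimately have bounded: "\<forall>\<^sub>F k in sequentially. \<bar>G k (u k)\<bar> \<le> \<bar>H1_dual_norm (G k)\<bar> * (2 * M / \<theta> + 2)"
  proof eventually_elim
    case (elim k)
    have h1: "h k \<le> 1 + (h k)\<^sup>2"
      using sum_squares_bound[of "h k" 1] h(1)[of k] by simp
    have "\<theta> * (h k)\<^sup>2 \<le> \<theta> * N k"
      using h \<theta> by simp
    \<comment> \<open>Subtracting the pairing divided by \<open>p + 1\<close> cancels the power
      term.\<close>
    also have "\<dots> = F_plus s p (u k) - G k (u k) / (p + 1)"
      by (simp add: F_plus_eq G_eq N_def P_def \<theta>_def diff_divide_distrib algebra_simps)
    also have "\<dots> \<le> M + \<bar>G k (u k)\<bar>"
    proof -
      have "\<bar>G k (u k) / (p + 1)\<bar> \<le> \<bar>G k (u k)\<bar>"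
        using p(1) by (simp add: abs_divide divide_le_eq mult_le_cancel_left1)
      with elim(1) show ?thesis
        unfolding less_ereal.simps by linarith
    qed
    also have "\<bar>G k (u k)\<bar> \<le> \<theta> / 2 * (1 + (h k)\<^sup>2)"
      using G_le[of k] elim(2) h1 h(1)[of k] \<theta>
      by (meson order_trans mult_mono less_imp_le half_gt_zero)
    finally have "\<theta> * (h k)\<^sup>2 \<le> 2 * M + \<theta>"
      by (simp add: algebra_simps)
    then have "(h k)\<^sup>2 \<le> 2 * M / \<theta> + 1"
      using \<theta> by (simp add: field_simps)
    then have "h k \<le> 2 * M / \<theta> + 2"
      using h1 by simp
    with h(1)[of k] show ?case
      by (intro order_trans[OF G_le] mult_mono) auto
  qed
  have "(\<lambda>k. \<bar>H1_dual_norm (G k)\<bar> * (2 * M / \<theta> + 2)) \<longlonglongrightarrow> \<bar>0\<bar> * (2 * M / \<theta> + 2)"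
    by (intro tendsto_intros gradient_to_0)
  then have G_to_0: "(\<lambda>k. G k (u k)) \<longlonglongrightarrow> 0"
    using bounded by (intro Lim_null_comparison[of "\<lambda>k. G k (u k)"]) auto

  \<comment> \<open>The energies dominate half the pairing because \<open>\<theta> * P k\<close> is
    nonnegative. Together with \<open>level_le\<close> this makes the extended real level a real
    number \<open>r\<close>.\<close>
  have "0 \<le> ?c"
  proof (rule LIMSEQ_le)
    show "(\<lambda>k. ereal (G k (u k) / 2)) \<longlonglongrightarrow> 0"
      using tendsto_divide[OF G_to_0 tendsto_const, of 2] by (simp add: zero_ereal_def)
    show "\<exists>m. \<forall>k\<ge>m. ereal (G k (u k) / 2) \<le> ereal (F_plus s p (u k))"
      using \<theta> by (simp add: F_eq P_def pos_power_integral_nonneg)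
  qed (rule level)
  with level_le obtain r where r: "?c = ereal r" "0 \<le> r"
    by (cases ?c) auto
  have "(\<lambda>k. F_plus s p (u k)) \<longlonglongrightarrow> r"
    using level unfolding r by simp
  then have "(\<lambda>k. (F_plus s p (u k) - G k (u k) / 2) / \<theta>) \<longlonglongrightarrow> (r - 0 / 2) / \<theta>"
    using \<theta> by (intro tendsto_intros G_to_0) auto
  then have P_lim: "P \<longlonglongrightarrow> r / \<theta>"
    using \<theta> by (simp add: F_eq)

  have [measurable]: "u k \<in> borel_measurable borel" "ubar \<in> borel_measurable borel" for k
    using u_H1[of k] ubar by (auto simp: H1_def L2_measurable)
  text \<open>If the power of the positive part were not integrable, the Bochner integral in
    \<^const>\<open>F_plus\<close> would be 0 and \<open>G k (u k)\<close> would equal the full squared norm;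
    as \<open>G k (u k)\<close> tends to 0, this can only happen finitely often.\<close>
  have integrable: "\<forall>\<^sub>F k in sequentially. integrable lborel (\<lambda>x. max (u k x) 0 powr (p + 1))"
  proof (rule ccontr)
    assume *: "\<not> ?thesis"
    have "ereal 2 < sobolev_exponent DIM('a)"
      by (auto simp: sobolev_exponent_def field_simps)
    then have conv: "Lq_loc_converges 2 (\<lambda>k x. u k (x + y k)) ubar"
      by (intro strong) auto
    \<comment> \<open>At a bad index \<open>P k = 0\<close>, so the squared L2 norm is at most
      \<open>N k = G k (u k)\<close>. Semicontinuity with bound 0 then forces \<open>ubar\<close> to
      vanish.\<close>
    have "(\<integral>\<^sup>+x. ennreal (\<bar>ubar x\<bar> powr 2) \<partial>lborel) \<le> ennreal 0"
    proof (rule Lq_loc_lower_semicontinuous[OF _ conv])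
      fix e :: real assume "e > 0"
      then have "\<forall>\<^sub>F k in sequentially. G k (u k) < e"
        by (rule order_tendstoD(2)[OF G_to_0])
      with * have "\<exists>\<^sub>F k in sequentially.
          \<not> integrable lborel (\<lambda>x. max (u k x) 0 powr (p + 1)) \<and> G k (u k) < e"
        by (simp add: not_eventually frequently_eventually_frequently)
      then show "\<exists>\<^sub>F k in sequentially. (\<integral>\<^sup>+x. ennreal (\<bar>u k (x + y k)\<bar> powr 2) \<partial>lborel) \<le> ennreal (0 + e)"
      proof (rule frequently_elim1)
        fix k assume k: "\<not> integrable lborel (\<lambda>x. max (u k x) 0 powr (p + 1)) \<and> G k (u k) < e"
        then have "P k = 0"
          by (simp add: P_def pos_power_integral_def not_integrable_integral_eq)
        then have "(LINT x|lborel. (u k x)\<^sup>2) \<le> e"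
          using L2_integral_le_H1_norm_sq[of "u k"] h(2)[of k] G_eq[of k] k by (simp add: h_def)
        moreover have "integrable lborel (\<lambda>x. (u k x)\<^sup>2)"
          using u_H1[of k] by (simp add: H1_def L2_def)
        ultimately have "(\<integral>\<^sup>+x. ennreal (\<bar>u k x\<bar> powr 2) \<partial>lborel) \<le> ennreal e"
          by (simp add: nn_integral_eq_integral ennreal_leI)
        then show "(\<integral>\<^sup>+x. ennreal (\<bar>u k (x + y k)\<bar> powr 2) \<partial>lborel) \<le> ennreal (0 + e)"
          using nn_integral_lborel_translate[of "\<lambda>x. ennreal (\<bar>u k x\<bar> powr 2)" "y k"] by simp
      qed
    qed auto
    then have "AE x in lborel. ennreal (\<bar>ubar x\<bar> powr 2) = 0"
      by (subst (asm) ennreal_0, subst (asm) le_zero_eq, subst (asm) nn_integral_0_iff_AE) auto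
    then have "AE x in lborel. ubar x = 0"
      by eventually_elim simp
    with nontrivial show False by simp
  qed

  \<comment> \<open>For n > 2 this is exactly subcriticality, as 2n/(n-2) - 1 = (n+2)/(n-2).\<close>
  have "ereal (p + 1) < sobolev_exponent DIM('a)"
    using p by (auto simp: sobolev_exponent_def field_simps)
  then have conv: "Lq_loc_converges (p + 1) (\<lambda>k x. u k (x + y k)) ubar"
    using p(1) by (intro strong) auto
  \<comment> \<open>Semicontinuity for the positive part; eventual integrability identifies
    \<open>P k\<close> with the nonnegative integral.\<close>
  have "(\<integral>\<^sup>+x. ennreal (\<bar>max (ubar x) 0\<bar> powr (p + 1)) \<partial>lborel) \<le> ennreal (r / \<theta>)"
  proof (rule Lq_loc_lower_semicontinuous[OF _ conv])
    fix e :: real assume "e > 0"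
    then have "\<forall>\<^sub>F k in sequentially. P k < r / \<theta> + e"
      using P_lim by (intro order_tendstoD(2)) auto
    with integrable have "\<forall>\<^sub>F k in sequentially.
        (\<integral>\<^sup>+x. ennreal (\<bar>max (u k (x + y k)) 0\<bar> powr (p + 1)) \<partial>lborel) \<le> ennreal (r / \<theta> + e)"
    proof eventually_elim
      case (elim k)
      then show ?case
        using nn_integral_lborel_translate[of "\<lambda>x. ennreal (max (u k x) 0 powr (p + 1))" "y k"]
        by (simp add: nn_integral_eq_integral ennreal_leI P_def pos_power_integral_def)
    qed
    then show "\<exists>\<^sub>F k in sequentially.
        (\<integral>\<^sup>+x. ennreal (\<bar>max (u k (x + y k)) 0\<bar> powr (p + 1)) \<partial>lborel) \<le> ennreal (r / \<theta> + e)"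
      by (rule eventually_frequently[rotated]) simp
  qed (use p(1) r(2) \<theta> in auto)
  then have "pos_power_integral (p + 1) ubar \<le> r / \<theta>"
    using r(2) \<theta> unfolding pos_power_integral_def by (intro integral_real_bounded) auto
  \<comment> \<open>By \<open>Fubar\<close> the critical value is \<theta> times the power integral;
    the reverse inequality is \<open>level_le\<close>.\<close>
  then have "F_plus s p ubar \<le> r"
    using \<theta> by (simp add: Fubar field_simps)
  with level_le show ?thesis
    by (simp add: r)
qed

end
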